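(* Let $(S)$ be a Hopf SDSE (with $F_i(0,\ldots,0)=1$ for all $i\in I$), let $i$ be a vertex of the graph $G_{(S)}$ and let $j$ be a direct descendant of $i$. 1. $i$ has level $0$ or $1$ if, and only if, $j$ has level $0$. 2. Let $M\ge2$. Then $i$ has level $M$ if, and only if, $j$ has level $M-1$. Moreover, if this holds (i.e. if $i$ and $j$ have finite level), then $b^{(i)}_k=b^{(j)}_k$ for all $k\in I$.
   Context: $K$ is a field of characteristic zero and $I$ a finite non-empty set. $\mathcal{H}_I$ is the (Connes-Kreimer) polynomial algebra generated by the set of (isomorphism classes of non-planar) rooted trees whose vertices are decorated by elements of $I$; monomials are forests; it is graded by the number of vertices, and $\widehat{\mathcal H_I}=\prod_n\mathcal H_I(n)$ is its completion. The coproduct is the algebra morphism with $\Delta(t)=t\otimes1+1\otimes t+\sum_cP^c(t)\otimes R^c(t)$ for each tree $t$, where $c$ runs over non-empty sets of edges of $t$ such that every path from the root to a leaf meets at most one edge of $c$; after deleting the edges of $c$, $R^c(t)$ is the component containing the root and $P^c(t)$ is the product of the other components. This makes $\mathcal H_I$ a Hopf algebra. $B_i^+$ is the linear (continuous) operator sending a forest to the tree obtained by grafting its trees on a common root decorated by $i$. The SDSE $(S)$ associated to non-constant series $(F_i)_{i\in I}$, $F_i\in K[[h_j,j\in I]]$, is the system $X_i=B_i^+(F_i(X_j,j\in I))$, $i\in I$; it has a unique solution $(X_i)_{i\in I}\in\widehat{\mathcal H_I}^{\,I}$. $X_i(n)$ is the homogeneous component of degree $n$ of $X_i$, and $\mathcal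 H_{(S)}$ is the subalgebra of $\mathcal H_I$ generated by all the $X_i(n)$. $(S)$ is Hopf if $\mathcal H_{(S)}$ is a Hopf subalgebra of $\mathcal H_I$. The graph $G_{(S)}$ has vertex set $I$ and an oriented edge $i\to j$ iff $\partial F_i/\partial h_j\ne0$; then $j$ is a direct descendant of $i$. Write $X_i=\sum_ta_tt$, the sum over trees with root decorated by $i$, and let $\mathcal T_i(n)$ be the set of trees with $n$ vertices and root decorated by $i$. For a Hopf SDSE, for all $i,j\in I$, $n\ge1$, $\lambda_n^{(i,j)}$ is the (unique) scalar such that $\sum_{t\in\mathcal T_i(n+1)}n_j(t,t')a_t=\lambda_n^{(i,j)}a_{t'}$ for all $t'\in\mathcal T_i(n)$, where $n_j(t,t')$ is the number of leaves of $t$ decorated by $j$ whose removal gives $t'$. A vertex $i$ is of level $\le M$ ($M\in\mathbb N$) if for every vertex $j$ there exist scalars $b^{(i)}_j,\tilde a^{(i)}_j$ such that $\lambda_n^{(i,j)}=b^{(i)}_j(n-1)+\tilde a^{(i)}_j$ for all $n>M$. It is of level $M$ if it is of level $\le M$ and not of level $\le M-1$. It is of finite level if it is of level $M$ for some $M\in\mathbb N$; the $b^{(i)}_j$ are then uniquely determined. *)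

theory Defs
  imports
    "HOL-Library.Poly_Mapping"
    "HOL-Library.Product_Plus"
    "HOL-Library.Groups_Big_Fun"
    "HOL-Library.Multiset"
    "HOL-Library.Sublist"
    "HOL-Computational_Algebra.Formal_Power_Series"
begin

section \<open>Decorated rooted trees\<close>

text \<open>
  Since children form a multiset, elements of this type are isomorphism classes of non-planar
  rooted trees with decorated vertices.
\<close>

datatype 'i rtree = Node (root: 'i) (children: "'i rtree multiset")

primrec nvert :: "'i rtree \<Rightarrow> nat" where
  "nvert (Node i ts) = Suc (sum_mset (image_mset nvert ts))"

type_synonym 'i forest = "'i rtree multiset"

definition nvert_forest :: "'i forest \<Rightarrow> nat" where
  "nvert_forest G = (\<Sum>t\<in>#G. nvert t)"

text \<open>
  An isomorphism class has no concrete vertices and edges. To speak about sets of edges we choose a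
  planar representative of the class; all notions below that are transported to isomorphism classes
  are invariant under isomorphism and hence do not depend on this choice.
\<close>

datatype 'i ptree = PNode (plabel: 'i) (psubs: "'i ptree list")

primrec forget :: "'i ptree \<Rightarrow> 'i rtree" where
  "forget (PNode i ps) = Node i (mset (map forget ps))"

lemma forget_surj: "\<exists>p. forget p = t"
proof (induction t)
  case (Node i ts)
  then obtain f where f: "\<And>t. t \<in># ts \<Longrightarrow> forget (f t) = t" by metis
  obtain xs where xs: "mset xs = ts" using ex_mset by blast
  have "map (\<lambda>x. forget (f x)) xs = xs"
    using f xs by (intro map_idI) auto
  then have "forget (PNode i (map f xs)) = Node i ts" using xs by (simp add: comp_def)
  then show ?case by blast
qed

definition planar :: "'i rtree \<Rightarrow> 'i ptree" where
  "planar t = (SOME p. forget p = t)"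

lemma forget_planar: "forget (planar t) = t"
  unfolding planar_def by (rule someI_ex) (rule forget_surj)

text \<open>
  A vertex is addressed by the list of child positions that leads to it from the root. An edge is
  represented by its lower endpoint, so edges are the non-root vertices, and the edges on the path
  from the root to a vertex are the non-empty prefixes of its address.
\<close>

primrec subtree_at :: "nat list \<Rightarrow> 'i ptree \<Rightarrow> 'i ptree option" where
  "subtree_at [] p = Some p"
| "subtree_at (k # v) p =
     (if k < length (psubs p) then subtree_at v (psubs p ! k) else None)"

definition vertices :: "'i ptree \<Rightarrow> nat list set" where
  "vertices p = {v. subtree_at v p \<noteq> None}"

definition edges :: "'i ptree \<Rightarrow> nat list set" where
  "edges p = vertices p - {[]}"

definition label_at :: "'i ptree \<Rightarrow> nat list \<Rightarrow> 'i" where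
  "label_at p v = plabel (the (subtree_at v p))"

definition leaves :: "'i ptree \<Rightarrow> nat list set" where
  "leaves p = {v \<in> vertices p. psubs (the (subtree_at v p)) = []}"

definition path_edges :: "nat list \<Rightarrow> nat list set" where
  "path_edges v = {e. prefix e v \<and> e \<noteq> []}"

definition admissible :: "'i ptree \<Rightarrow> nat list set \<Rightarrow> bool" where
  "admissible p c \<longleftrightarrow>
     c \<subseteq> edges p \<and> c \<noteq> {} \<and> (\<forall>l\<in>leaves p. card (c \<inter> path_edges l) \<le> 1)"

text \<open>
  \<open>root_component c p\<close> is the connected component of the root after the edges in \<open>c\<close> have been
  deleted from \<open>p\<close>; \<open>component c p v\<close> is the component whose uppermost vertex is \<open>v\<close>.
\<close>

function root_component :: "nat list set \<Rightarrow> 'i ptree \<Rightarrow> 'i rtree" where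
  "root_component c (PNode i ps) =
     Node i (mset (map (\<lambda>k. root_component {w. k # w \<in> c} (ps ! k))
       (filter (\<lambda>k. [k] \<notin> c) [0..<length ps])))"
  by pat_completeness auto
termination
proof (relation "measure (\<lambda>(c, p). size p)", goal_cases)
  case 1
  then show ?case by simp
next
  case (2 c i ps k)
  then have "ps ! k \<in> set ps" by auto
  then have "size (ps ! k) < Suc (size_list size ps)"
    using size_list_estimation'[of "ps ! k" ps "size (ps ! k)" size] by simp
  then show ?case by simp
qed

definition component :: "nat list set \<Rightarrow> 'i ptree \<Rightarrow> nat list \<Rightarrow> 'i rtree" where
  "component c p v = root_component {w. v @ w \<in> c} (the (subtree_at v p))"

definition cut_trunk :: "'i ptree \<Rightarrow> nat list set \<Rightarrow> 'i rtree" where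
  "cut_trunk p c = component c p []"

definition cut_branches :: "'i ptree \<Rightarrow> nat list set \<Rightarrow> 'i forest" where
  "cut_branches p c = image_mset (component c p) (mset_set c)"

definition leaf_count :: "'i \<Rightarrow> 'i rtree \<Rightarrow> 'i rtree \<Rightarrow> nat" where
  "leaf_count j t t' =
     card {l \<in> leaves (planar t) \<inter> edges (planar t).
       label_at (planar t) l = j \<and> cut_trunk (planar t) {l} = t'}"


section \<open>The Connes-Kreimer Hopf algebra\<close>

text \<open>
  Forests are the monomials; their product is the sum of multisets. Thus \<open>('i, 'k) ck\<close> is the
  polynomial algebra over the trees, and \<open>('i, 'k) ck2\<close> is its tensor square, with basis the
  pairs of forests.
\<close>

type_synonym ('i, 'k) ck = "'i forest \<Rightarrow>\<^sub>0 'k"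
type_synonym ('i, 'k) ck2 = "('i forest \<times> 'i forest) \<Rightarrow>\<^sub>0 'k"

definition scale :: "'k::field \<Rightarrow> ('a::comm_monoid_add \<Rightarrow>\<^sub>0 'k) \<Rightarrow> ('a \<Rightarrow>\<^sub>0 'k)" where
  "scale c f = Poly_Mapping.single 0 c * f"

lemma module_scale: "module scale"
  by unfold_locales
    (simp_all add: scale_def algebra_simps single_add Poly_Mapping.mult_single flip: mult.assoc)

definition monom :: "'a \<Rightarrow> ('a \<Rightarrow>\<^sub>0 'k::field)" where
  "monom u = Poly_Mapping.single u 1"

definition lin_ext :: "('a \<Rightarrow> ('b::comm_monoid_add \<Rightarrow>\<^sub>0 'k)) \<Rightarrow> ('a \<Rightarrow>\<^sub>0 'k::field) \<Rightarrow> ('b \<Rightarrow>\<^sub>0 'k)" where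
  "lin_ext \<phi> f = (\<Sum>u\<in>Poly_Mapping.keys f. scale (Poly_Mapping.lookup f u) (\<phi> u))"

definition tensor :: "('i, 'k::field) ck \<Rightarrow> ('i, 'k) ck \<Rightarrow> ('i, 'k) ck2" where
  "tensor f g = lin_ext (\<lambda>u. lin_ext (\<lambda>v. monom (u, v)) g) f"

definition coprod_tree :: "'i rtree \<Rightarrow> ('i, 'k::field) ck2" where
  "coprod_tree t =
     tensor (monom {#t#}) 1 + tensor 1 (monom {#t#}) +
     (\<Sum>c | admissible (planar t) c.
        tensor (monom (cut_branches (planar t) c)) (monom {#cut_trunk (planar t) c#}))"

definition coprod :: "('i, 'k::field) ck \<Rightarrow> ('i, 'k) ck2" where
  "coprod = lin_ext (\<lambda>G. \<Prod>t\<in>#G. coprod_tree t)"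

definition counit :: "('i, 'k::field) ck \<Rightarrow> 'k" where
  "counit f = Poly_Mapping.lookup f {#}"

definition is_antipode :: "(('i, 'k::field) ck \<Rightarrow> ('i, 'k) ck) \<Rightarrow> bool" where
  "is_antipode S \<longleftrightarrow> module_hom scale scale S \<and>
     (\<forall>f. lin_ext (\<lambda>(u, v). S (monom u) * monom v) (coprod f) = scale (counit f) 1 \<and>
          lin_ext (\<lambda>(u, v). monom u * S (monom v)) (coprod f) = scale (counit f) 1)"

definition antipode :: "('i, 'k::field) ck \<Rightarrow> ('i, 'k) ck" where
  "antipode = (THE S. is_antipode S)"

definition subalgebra :: "('i, 'k::field) ck set \<Rightarrow> bool" where
  "subalgebra A \<longleftrightarrow> module.subspace scale A \<and> 1 \<in> A \<and> (\<forall>x\<in>A. \<forall>y\<in>A. x * y \<in> A)"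

definition hopf_subalgebra :: "('i, 'k::field) ck set \<Rightarrow> bool" where
  "hopf_subalgebra A \<longleftrightarrow> subalgebra A \<and>
     coprod ` A \<subseteq> module.span scale {tensor x y | x y. x \<in> A \<and> y \<in> A} \<and>
     antipode ` A \<subseteq> A"

definition homogeneous :: "nat \<Rightarrow> ('i, 'k::field) ck set" where
  "homogeneous n = {f. \<forall>G\<in>Poly_Mapping.keys f. nvert_forest G = n}"


section \<open>Systems of Dyson-Schwinger equations\<close>

text \<open>
  An element of the completion is the sequence of its homogeneous components, and the product of the
  completion is the Cauchy product. So the completion is a subalgebra of the formal power series
  over the algebra; the formal variable records the degree.
\<close>

type_synonym ('i, 'k) ck_series = "('i, 'k) ck fps"

definition completion :: "('i, 'k::field) ck_series set" where
  "completion = {x. \<forall>n. fps_nth x n \<in> homogeneous n}"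

definition graft :: "'i \<Rightarrow> ('i, 'k::field) ck \<Rightarrow> ('i, 'k) ck" where
  "graft i = lin_ext (\<lambda>G. monom {#Node i G#})"

definition graft_series :: "'i \<Rightarrow> ('i, 'k::field) ck_series \<Rightarrow> ('i, 'k) ck_series" where
  "graft_series i x =
     Abs_fps (\<lambda>n. case n of 0 \<Rightarrow> 0 | Suc m \<Rightarrow> graft i (fps_nth x m))"

text \<open>
  A formal power series in the commuting variables \<open>h j\<close> is its coefficient function. Exponents are
  multisets: the coefficient of the product of \<open>h j ^ count \<alpha> j\<close> is the value at \<open>\<alpha>\<close>.
\<close>

type_synonym ('i, 'k) mfps = "'i multiset \<Rightarrow> 'k"

definition nonconstant :: "('i, 'k::field) mfps \<Rightarrow> bool" where
  "nonconstant f \<longleftrightarrow> (\<exists>\<alpha>. \<alpha> \<noteq> {#} \<and> f \<alpha> \<noteq> 0)"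

definition mfps_deriv :: "'i \<Rightarrow> ('i, 'k::field) mfps \<Rightarrow> ('i, 'k) mfps" where
  "mfps_deriv j f = (\<lambda>\<alpha>. of_nat (Suc (count \<alpha> j)) * f (add_mset j \<alpha>))"

text \<open>
  Substitution is computed degree by degree. If the \<open>X j\<close> have no component of degree 0 and there
  are finitely many variables, only finitely many summands are non-zero in each degree; a tuple that
  solves a system below always satisfies the former, as grafting produces no component of degree 0.
\<close>

definition mfps_subst ::
    "('i, 'k::field) mfps \<Rightarrow> ('i \<Rightarrow> ('i, 'k) ck_series) \<Rightarrow> ('i, 'k) ck_series" where
  "mfps_subst f X =
     Abs_fps (\<lambda>n. Sum_any (\<lambda>\<alpha>. scale (f \<alpha>) (fps_nth (\<Prod>j\<in>#\<alpha>. X j) n)))"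

definition dse_solution ::
    "('i \<Rightarrow> ('i, 'k::field) mfps) \<Rightarrow> ('i \<Rightarrow> ('i, 'k) ck_series) \<Rightarrow> bool" where
  "dse_solution F X \<longleftrightarrow>
     (\<forall>i. X i \<in> completion) \<and> (\<forall>i. X i = graft_series i (mfps_subst (F i) X))"

definition dse_sol :: "('i \<Rightarrow> ('i, 'k::field) mfps) \<Rightarrow> 'i \<Rightarrow> ('i, 'k) ck_series" where
  "dse_sol F = (THE X. dse_solution F X)"

definition dse_algebra :: "('i \<Rightarrow> ('i, 'k::field) mfps) \<Rightarrow> ('i, 'k) ck set" where
  "dse_algebra F = subalgebra hull {fps_nth (dse_sol F i) n | i n. True}"

definition hopf_dse :: "('i \<Rightarrow> ('i, 'k::field) mfps) \<Rightarrow> bool" where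
  "hopf_dse F \<longleftrightarrow> hopf_subalgebra (dse_algebra F)"

text \<open>The graph of the system: its vertices are all elements of \<open>'i\<close>.\<close>

definition direct_descendant :: "('i \<Rightarrow> ('i, 'k::field) mfps) \<Rightarrow> 'i \<Rightarrow> 'i \<Rightarrow> bool" where
  "direct_descendant F i j \<longleftrightarrow> mfps_deriv j (F i) \<noteq> (\<lambda>\<alpha>. 0)"


section \<open>The structure coefficients and the level of a vertex\<close>

definition trees :: "'i \<Rightarrow> nat \<Rightarrow> 'i rtree set" where
  "trees i n = {t. root t = i \<and> nvert t = n}"

definition tree_coeff :: "('i \<Rightarrow> ('i, 'k::field) mfps) \<Rightarrow> 'i rtree \<Rightarrow> 'k" where
  "tree_coeff F t = Poly_Mapping.lookup (fps_nth (dse_sol F (root t)) (nvert t)) {#t#}"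

text \<open>Only meaningful for \<open>n \<ge> 1\<close> and Hopf systems, where the scalar exists and is unique.\<close>

definition lambda :: "('i \<Rightarrow> ('i, 'k::field) mfps) \<Rightarrow> 'i \<Rightarrow> 'i \<Rightarrow> nat \<Rightarrow> 'k" where
  "lambda F i j n = (THE l. \<forall>t'\<in>trees i n.
     (\<Sum>t\<in>trees i (Suc n). of_nat (leaf_count j t t') * tree_coeff F t) = l * tree_coeff F t')"

definition level_le :: "('i \<Rightarrow> ('i, 'k::field) mfps) \<Rightarrow> nat \<Rightarrow> 'i \<Rightarrow> bool" where
  "level_le F M i \<longleftrightarrow>
     (\<forall>j. \<exists>b a. \<forall>n>M. lambda F i j n = b * (of_nat n - 1) + a)"

text \<open>
  There is no level below 0, so the second condition is void for \<open>M = 0\<close> (and must be written out,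
  since subtraction on natural numbers truncates).
\<close>

definition has_level :: "('i \<Rightarrow> ('i, 'k::field) mfps) \<Rightarrow> 'i \<Rightarrow> nat \<Rightarrow> bool" where
  "has_level F i M \<longleftrightarrow> level_le F M i \<and> (M = 0 \<or> \<not> level_le F (M - 1) i)"

definition finite_level :: "('i \<Rightarrow> ('i, 'k::field) mfps) \<Rightarrow> 'i \<Rightarrow> bool" where
  "finite_level F i \<longleftrightarrow> (\<exists>M. has_level F i M)"

definition level_slope :: "('i \<Rightarrow> ('i, 'k::field) mfps) \<Rightarrow> 'i \<Rightarrow> 'i \<Rightarrow> 'k" where
  "level_slope F i k = (THE b. \<exists>M a. has_level F i M \<and>
     (\<forall>n>M. lambda F i k n = b * (of_nat n - 1) + a))"

end

theory Submission
  imports Defs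
begin

text \<open>
  Let \<open>u\<close> be a tree with root \<open>j\<close>, \<open>n\<close> vertices and non-zero coefficient, where \<open>j\<close> is a direct
  descendant of \<open>i\<close>. A leaf \<open>k\<close> can be added to the tree that has root \<open>i\<close> and \<open>u\<close> as its only
  branch either at the root or inside \<open>u\<close>. Comparing coefficients in the equation that defines the
  structure coefficients gives \<open>\<lambda>\<^sub>n\<^sub>+\<^sub>1(i,k) = C + \<lambda>\<^sub>n(j,k)\<close>, with \<open>C\<close> depending only on the coefficients
  of \<open>F\<^sub>i\<close> of degree at most 2. Hence \<open>\<lambda>(i,k)\<close> is affine beyond \<open>M + 1\<close> if and only if \<open>\<lambda>(j,k)\<close> is
  affine beyond \<open>M\<close>, with the same slope.

  The structure coefficients exist because the elements whose coefficients on single trees with root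
  \<open>i\<close> and \<open>n\<close> vertices are proportional to those of \<open>X\<^sub>i\<close> form a subalgebra containing all \<open>X\<^sub>k(m)\<close>,
  and cutting off one leaf reads such an element off the coproduct of \<open>X\<^sub>i(n + 1)\<close>.
\<close>

section \<open>Coefficients of scalings, tensors, products and grafts\<close>

lemma lookup_scale [simp]: "Poly_Mapping.lookup (scale c f) u = c * Poly_Mapping.lookup f u"
  by (simp add: scale_def flip: mult_map_scale_conv_mult) (simp add: Poly_Mapping.map.rep_eq when_def)

lemma lookup_monom: "Poly_Mapping.lookup (monom u) v = (if u = v then 1 else 0)"
  by (simp add: monom_def lookup_single when_def)

lemma lookup_lin_ext:
  "Poly_Mapping.lookup (lin_ext \<phi> f) v =
    (\<Sum>u\<in>Poly_Mapping.keys f. Poly_Mapping.lookup f u * Poly_Mapping.lookup (\<phi> u) v)"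
  by (simp add: lin_ext_def lookup_sum)

lemma lookup_tensor [simp]:
  "Poly_Mapping.lookup (tensor f g) (u, v) = Poly_Mapping.lookup f u * Poly_Mapping.lookup g v"
proof -
  have "Poly_Mapping.lookup (lin_ext (\<lambda>v. monom (u', v)) g) (u, v) =
      (if u' = u then Poly_Mapping.lookup g v else 0)" for u'
    by (auto simp: lookup_lin_ext lookup_monom mult_delta_right in_keys_iff)
  then show ?thesis by (auto simp: tensor_def lookup_lin_ext mult_delta_right in_keys_iff)
qed

text \<open>Since \<open>f\<close> is supported on one-element multisets, a factorisation of
  \<open>G\<close> amounts to choosing the element taken from \<open>f\<close>. Equal elements give
  the same factorisation, so the sum runs over distinct elements.\<close>

lemma lookup_mult_singletons:
  fixes f g :: "('a multiset, 'k::field) poly_mapping"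
  assumes f: "\<And>G. G \<in> Poly_Mapping.keys f \<Longrightarrow> \<exists>t. G = {#t#}"
  shows "Poly_Mapping.lookup (f * g) G =
    (\<Sum>t\<in>set_mset G. Poly_Mapping.lookup f {#t#} * Poly_Mapping.lookup g (G - {#t#}))"
proof -
  have inner: "(\<Sum>q. Poly_Mapping.lookup g q when G = l + q) =
      (if l \<subseteq># G then Poly_Mapping.lookup g (G - l) else 0)" for l
  proof (cases "l \<subseteq># G")
    case True
    then have "G = l + q \<longleftrightarrow> q = G - l" for q by auto
    then show ?thesis using True by (simp add: when_def)
  next
    case False
    then have "G \<noteq> l + q" for q by auto
    then show ?thesis using False by (simp add: when_def)
  qed
  let ?h = "\<lambda>l. Poly_Mapping.lookup f l * (if l \<subseteq># G then Poly_Mapping.lookup g (G - l) else 0)"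
  have "Poly_Mapping.lookup (f * g) G = Sum_any ?h"
    by (simp add: lookup_mult inner)
  also have "\<dots> = sum ?h ((\<lambda>t. {#t#}) ` set_mset G)"
  proof (rule Sum_any.expand_superset)
    show "{a. ?h a \<noteq> 0} \<subseteq> (\<lambda>t. {#t#}) ` set_mset G"
    proof
      fix l assume "l \<in> {a. ?h a \<noteq> 0}"
      then have "l \<in> Poly_Mapping.keys f" "l \<subseteq># G" by (auto simp: in_keys_iff split: if_splits)
      with f[of l] show "l \<in> (\<lambda>t. {#t#}) ` set_mset G" by auto
    qed
  qed simp
  also have "\<dots> = (\<Sum>t\<in>set_mset G. Poly_Mapping.lookup f {#t#} * Poly_Mapping.lookup g (G - {#t#}))"
    by (subst sum.reindex) (auto simp: inj_on_def intro!: sum.cong)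
  finally show ?thesis .
qed

lemma lookup_graft:
  "Poly_Mapping.lookup (graft i f) {#Node k G#} = (if k = i then Poly_Mapping.lookup f G else 0)"
  by (auto simp: graft_def lookup_lin_ext lookup_monom if_distrib sum.delta'
      not_in_keys_iff_lookup_eq_zero cong: if_cong)

lemma keys_graft: "H \<in> Poly_Mapping.keys (graft i f) \<Longrightarrow> \<exists>G\<in>Poly_Mapping.keys f. H = {#Node i G#}"
  by (auto simp: graft_def in_keys_iff lookup_lin_ext lookup_monom split: if_splits
      elim!: sum.not_neutral_contains_not_neutral)

section \<open>The solution of a system\<close>

definition dse_step ::
    "('i \<Rightarrow> ('i, 'k::field) mfps) \<Rightarrow> ('i \<Rightarrow> ('i, 'k) ck_series) \<Rightarrow> 'i \<Rightarrow> ('i, 'k) ck_series" where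
  "dse_step F X i = graft_series i (mfps_subst (F i) X)"

lemma fps_nth_prod_mset_cong:
  fixes X Y :: "'i \<Rightarrow> 'a::comm_ring_1 fps"
  assumes "\<And>j m. m \<le> n \<Longrightarrow> fps_nth (X j) m = fps_nth (Y j) m"
  shows "m \<le> n \<Longrightarrow> fps_nth (\<Prod>j\<in>#\<alpha>. X j) m = fps_nth (\<Prod>j\<in>#\<alpha>. Y j) m"
proof (induction \<alpha> arbitrary: m)
  case (add j \<alpha>)
  then show ?case using assms by (auto simp: fps_mult_nth intro!: sum.cong)
qed simp

lemma dse_step_nth_0 [simp]: "fps_nth (dse_step F X i) 0 = 0"
  by (simp add: dse_step_def graft_series_def)

lemma dse_step_nth_Suc:
  "fps_nth (dse_step F X i) (Suc n) =
    graft i (Sum_any (\<lambda>\<alpha>. scale (F i \<alpha>) (fps_nth (\<Prod>j\<in>#\<alpha>. X j) n)))"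
  by (simp add: dse_step_def graft_series_def mfps_subst_def)

text \<open>Grafting raises the degree by one, so degree \<open>m\<close> of the result only sees
  smaller degrees of the argument.\<close>

lemma dse_step_cong:
  assumes "\<And>j m. m < n \<Longrightarrow> fps_nth (X j) m = fps_nth (Y j) m" "m \<le> n"
  shows "fps_nth (dse_step F X i) m = fps_nth (dse_step F Y i) m"
proof (cases m)
  case (Suc l)
  then have "fps_nth (\<Prod>j\<in>#\<alpha>. X j) l = fps_nth (\<Prod>j\<in>#\<alpha>. Y j) l" for \<alpha>
    using assms by (intro fps_nth_prod_mset_cong[where n = l]) auto
  then show ?thesis by (simp add: Suc dse_step_nth_Suc)
qed simp

lemma dse_step_fixpoint_unique:
  assumes X: "\<And>i. X i = dse_step F X i" and Y: "\<And>i. Y i = dse_step F Y i"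
  shows "X = Y"
proof -
  have "fps_nth (X i) n = fps_nth (Y i) n" for i n
  proof (induction n arbitrary: i rule: less_induct)
    case (less n)
    have "fps_nth (dse_step F X i) n = fps_nth (dse_step F Y i) n"
      using less by (intro dse_step_cong[where n = n]) auto
    then show ?case by (simp flip: X Y)
  qed
  then show ?thesis by (auto simp: fps_eq_iff)
qed

text \<open>
  The component of degree \<open>n\<close> of \<open>dse_step F X\<close> only depends on the components of \<open>X\<close> of smaller
  degree, so the iterates of \<open>dse_step F\<close> become stationary in each degree.
\<close>

lemma dse_step_fixpoint_exists: "\<exists>X. \<forall>i. X i = dse_step F X i"
proof -
  define Y where "Y n = (dse_step F ^^ n) (\<lambda>_. 0)" for n
  have Y_Suc: "Y (Suc n) = dse_step F (Y n)" for n by (simp add: Y_def)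
  have step: "fps_nth (Y (Suc n) i) m = fps_nth (Y n i) m" if "m < n" for n m i
    using that
  proof (induction n arbitrary: m i)
    case (Suc n)
    show ?case unfolding Y_Suc
      using Suc by (intro dse_step_cong[where n = n]) (auto simp: Y_Suc)
  qed simp
  have stable: "fps_nth (Y (n + d) i) m = fps_nth (Y n i) m" if "m < n" for n m i d
    using that step by (induction d) auto
  \<comment> \<open>The limit is a diagonal: by \<open>stable\<close>, iterate \<open>n + 1\<close>
    already has its final component in degree \<open>n\<close>.\<close>
  define X where "X i = Abs_fps (\<lambda>n. fps_nth (Y (Suc n) i) n)" for i
  have X: "fps_nth (X i) m = fps_nth (Y n i) m" if "m < n" for m n i
    using stable[of m "Suc m" "n - Suc m" i] that by (simp add: X_def)
  have "fps_nth (X i) m = fps_nth (dse_step F X i) m" for i m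
  proof -
    have "fps_nth (dse_step F X i) m = fps_nth (dse_step F (Y m) i) m"
      using X by (intro dse_step_cong[where n = m]) auto
    also have "\<dots> = fps_nth (X i) m" using X[of m "Suc m" i] by (simp add: Y_Suc)
    finally show ?thesis by simp
  qed
  then show ?thesis by (intro exI[of _ X]) (simp add: fps_eq_iff)
qed

section \<open>Homogeneity of the solution\<close>

lemma homogeneous_0: "0 \<in> homogeneous n"
  by (simp add: homogeneous_def)

lemma homogeneous_add: "f \<in> homogeneous n \<Longrightarrow> g \<in> homogeneous n \<Longrightarrow> f + g \<in> homogeneous n"
  using Poly_Mapping.keys_add[of f g] by (fastforce simp: homogeneous_def)

lemma homogeneous_sum: "(\<And>x. x \<in> A \<Longrightarrow> f x \<in> homogeneous n) \<Longrightarrow> sum f A \<in> homogeneous n"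
  by (induction A rule: infinite_finite_induct) (auto simp: homogeneous_0 homogeneous_add)

lemma homogeneous_scale: "f \<in> homogeneous n \<Longrightarrow> scale c f \<in> homogeneous n"
  by (auto simp: homogeneous_def in_keys_iff)

lemma homogeneous_mult:
  assumes "f \<in> homogeneous m" "g \<in> homogeneous n"
  shows "f * g \<in> homogeneous (m + n)"
  using assms keys_mult[of f g] by (fastforce simp: homogeneous_def nvert_forest_def)

lemma homogeneous_prod_mset:
  fixes X :: "'i \<Rightarrow> ('i, 'k::field) ck_series"
  assumes "\<And>j m. m \<le> n \<Longrightarrow> fps_nth (X j) m \<in> homogeneous m"
  shows "m \<le> n \<Longrightarrow> fps_nth (\<Prod>j\<in>#\<alpha>. X j) m \<in> homogeneous m"
proof (induction \<alpha> arbitrary: m)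
  case empty
  then show ?case by (auto simp: homogeneous_def nvert_forest_def)
next
  case (add j \<alpha>)
  have "fps_nth (X j) l * fps_nth (\<Prod>j\<in>#\<alpha>. X j) (m - l) \<in> homogeneous m" if "l \<le> m" for l
    using homogeneous_mult[of "fps_nth (X j) l" l _ "m - l"] assms add that by simp
  then show ?case by (auto simp: fps_mult_nth intro!: homogeneous_sum)
qed

lemma nvert_forest_Node: "nvert_forest {#Node i G#} = Suc (nvert_forest G)"
  by (simp add: nvert_forest_def)

lemma homogeneous_graft: "f \<in> homogeneous n \<Longrightarrow> graft i f \<in> homogeneous (Suc n)"
  by (auto simp: homogeneous_def nvert_forest_Node dest!: keys_graft)

text \<open>If the support is infinite, \<open>Sum_any\<close> is 0 by convention, which is
  homogeneous of every degree.\<close>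

lemma homogeneous_Sum_any: "(\<And>x. f x \<in> homogeneous n) \<Longrightarrow> Sum_any f \<in> homogeneous n"
  by (simp add: Sum_any.expand_set homogeneous_sum)

lemma dse_step_fixpoint_completion:
  assumes "\<And>i. X i = dse_step F X i"
  shows "X i \<in> completion"
proof -
  have "fps_nth (X i) n \<in> homogeneous n" for n
  proof (induction n arbitrary: i rule: less_induct)
    case (less n)
    have "fps_nth (dse_step F X i) n \<in> homogeneous n"
    proof (cases n)
      case (Suc m)
      then have "fps_nth (\<Prod>j\<in>#\<alpha>. X j) m \<in> homogeneous m" for \<alpha>
        using less by (intro homogeneous_prod_mset[where n = m]) auto
      then show ?thesis
        unfolding Suc dse_step_nth_Suc by (intro homogeneous_graft homogeneous_Sum_any homogeneous_scale)
    qed (simp add: homogeneous_0)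
    then show ?case by (simp flip: assms)
  qed
  then show ?thesis by (simp add: completion_def)
qed

text \<open>A fixpoint of \<open>dse_step\<close> lies in the completion automatically. It is
  therefore the unique \<open>dse_solution\<close>, and the definite description
  \<open>dse_sol\<close> denotes it.\<close>

lemma dse_sol_fixpoint: "dse_sol F i = dse_step F (dse_sol F) i"
  and dse_sol_completion: "dse_sol F i \<in> completion"
proof -
  obtain X where X: "\<forall>i. X i = dse_step F X i" using dse_step_fixpoint_exists by blast
  have "dse_sol F = X" unfolding dse_sol_def
  proof (rule the_equality)
    show "dse_solution F X" unfolding dse_solution_def
      using dse_step_fixpoint_completion[OF X[rule_format]] X[unfolded dse_step_def] by (rule conjI[OF allI])
    show "Y = X" if "dse_solution F Y" for Y
      using that X unfolding dse_solution_def dse_step_def[symmetric]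
      by (intro dse_step_fixpoint_unique[of Y F X]) (drule conjunct2, erule spec, erule spec)
  qed
  then show "dse_sol F i = dse_step F (dse_sol F) i" "dse_sol F i \<in> completion"
    using spec[OF X, of i] dse_step_fixpoint_completion[OF X[rule_format], of i] by simp_all
qed

section \<open>The coefficients of the solution\<close>

lemma keys_dse_sol:
  assumes "H \<in> Poly_Mapping.keys (fps_nth (dse_sol F i) n)"
  shows "\<exists>t\<in>trees i n. H = {#t#}"
proof -
  have step: "fps_nth (dse_sol F i) n = fps_nth (dse_step F (dse_sol F) i) n"
    by (subst dse_sol_fixpoint) simp
  have "n \<noteq> 0" using assms unfolding step by (cases n) auto
  then obtain m where m: "n = Suc m" by (cases n) auto
  obtain G where G: "H = {#Node i G#}"
    using keys_graft[of H i] assms unfolding step unfolding m dse_step_nth_Suc by blast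
  have "nvert_forest H = n"
    using dse_sol_completion[of F i] assms by (auto simp: completion_def homogeneous_def)
  with G have "Node i G \<in> trees i n" by (simp add: trees_def nvert_forest_def)
  with G show ?thesis by blast
qed

lemma lookup_dse_sol:
  "Poly_Mapping.lookup (fps_nth (dse_sol F i) n) {#t#} =
    (if t \<in> trees i n then tree_coeff F t else 0)"
proof (cases "t \<in> trees i n")
  case False
  then have "{#t#} \<notin> Poly_Mapping.keys (fps_nth (dse_sol F i) n)" using keys_dse_sol by fastforce
  with False show ?thesis by (simp add: in_keys_iff)
qed (auto simp: trees_def tree_coeff_def)

text \<open>Each factor contributes exactly one tree, whose root is the index of the factor. A
  forest thus occurs in only one product, which collapses the infinite sum over exponents in
  \<open>tree_coeff_Node\<close>.\<close>

lemma keys_prod_dse_sol: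
  "G \<in> Poly_Mapping.keys (fps_nth (\<Prod>j\<in>#\<alpha>. dse_sol F j) n) \<Longrightarrow>
    image_mset root G = \<alpha> \<and> nvert_forest G = n"
proof (induction \<alpha> arbitrary: G n)
  case empty
  then show ?case by (cases n) (auto simp: nvert_forest_def)
next
  case (add j \<alpha>)
  let ?P = "\<Prod>j\<in>#\<alpha>. dse_sol F j"
  from add.prems have "(\<Sum>m = 0..n. Poly_Mapping.lookup (fps_nth (dse_sol F j) m * fps_nth ?P (n - m)) G) \<noteq> 0"
    by (simp add: fps_mult_nth in_keys_iff lookup_sum)
  then obtain m where m: "m \<le> n" "G \<in> Poly_Mapping.keys (fps_nth (dse_sol F j) m * fps_nth ?P (n - m))"
    by (auto simp: in_keys_iff elim!: sum.not_neutral_contains_not_neutral)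
  then obtain A B where AB: "G = A + B" "A \<in> Poly_Mapping.keys (fps_nth (dse_sol F j) m)"
      "B \<in> Poly_Mapping.keys (fps_nth ?P (n - m))"
    using keys_mult by blast
  obtain t where "t \<in> trees j m" "A = {#t#}" using keys_dse_sol[OF AB(2)] by blast
  then show ?case using AB(1) add.IH[OF AB(3)] m(1) by (auto simp: trees_def nvert_forest_def)
qed

text \<open>By homogeneity, \<open>nvert_forest G\<close> is the only degree in which
  \<open>G\<close> can occur.\<close>

definition prod_coeff :: "('i \<Rightarrow> ('i, 'k::field) mfps) \<Rightarrow> 'i multiset \<Rightarrow> 'i forest \<Rightarrow> 'k" where
  "prod_coeff F \<alpha> G = Poly_Mapping.lookup (fps_nth (\<Prod>j\<in>#\<alpha>. dse_sol F j) (nvert_forest G)) G"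

lemma prod_coeff_empty [simp]: "prod_coeff F {#} {#} = 1"
  by (simp add: prod_coeff_def nvert_forest_def)

text \<open>The factor with index \<open>j\<close> supplies one tree \<open>t\<close> of
  \<open>G\<close>, the other factors supply the rest. Recursion over the exponent replaces an
  explicit multinomial formula.\<close>

lemma prod_coeff_add_mset:
  "prod_coeff F (add_mset j \<alpha>) G =
    (\<Sum>t | t \<in># G \<and> root t = j. tree_coeff F t * prod_coeff F \<alpha> (G - {#t#}))"
proof -
  let ?P = "\<Prod>j\<in>#\<alpha>. dse_sol F j" and ?n = "nvert_forest G"
  have nvert: "nvert_forest G = nvert t + nvert_forest (G - {#t#})" if "t \<in># G" for t
    using that unfolding nvert_forest_def by (metis insert_DiffM image_mset_add_mset sum_mset.add_mset)
  have "prod_coeff F (add_mset j \<alpha>) G =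
      (\<Sum>m = 0..?n. \<Sum>t\<in>set_mset G. Poly_Mapping.lookup (fps_nth (dse_sol F j) m) {#t#} *
        Poly_Mapping.lookup (fps_nth ?P (?n - m)) (G - {#t#}))"
    unfolding prod_coeff_def image_mset_add_mset prod_mset.add_mset fps_mult_nth lookup_sum
    by (intro sum.cong refl lookup_mult_singletons) (blast dest: keys_dse_sol)
  also have "\<dots> = (\<Sum>t\<in>set_mset G. \<Sum>m = 0..?n. Poly_Mapping.lookup (fps_nth (dse_sol F j) m) {#t#} *
        Poly_Mapping.lookup (fps_nth ?P (?n - m)) (G - {#t#}))"
    by (rule sum.swap)
  also have "\<dots> = (\<Sum>t\<in>set_mset G. if root t = j then tree_coeff F t * prod_coeff F \<alpha> (G - {#t#}) else 0)"
  proof (rule sum.cong[OF refl])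
    fix t assume t: "t \<in> set_mset G"
    \<comment> \<open>Only the degree \<open>m = nvert t\<close> can contain the tree
      \<open>t\<close>.\<close>
    have "(\<Sum>m = 0..?n. Poly_Mapping.lookup (fps_nth (dse_sol F j) m) {#t#} *
        Poly_Mapping.lookup (fps_nth ?P (?n - m)) (G - {#t#})) =
      (\<Sum>m = 0..?n. if m = nvert t then (if root t = j then tree_coeff F t * prod_coeff F \<alpha> (G - {#t#}) else 0) else 0)"
      using nvert[OF t] by (intro sum.cong) (auto simp: lookup_dse_sol trees_def prod_coeff_def)
    also have "\<dots> = (if root t = j then tree_coeff F t * prod_coeff F \<alpha> (G - {#t#}) else 0)"
      using nvert[OF t] by simp
    finally show "(\<Sum>m = 0..?n. Poly_Mapping.lookup (fps_nth (dse_sol F j) m) {#t#} *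
        Poly_Mapping.lookup (fps_nth ?P (?n - m)) (G - {#t#})) =
      (if root t = j then tree_coeff F t * prod_coeff F \<alpha> (G - {#t#}) else 0)" .
  qed
  also have "\<dots> = (\<Sum>t | t \<in># G \<and> root t = j. tree_coeff F t * prod_coeff F \<alpha> (G - {#t#}))"
    by (subst sum.inter_filter[symmetric]) auto
  finally show ?thesis .
qed

lemma nvert_neq_0 [simp]: "nvert t \<noteq> 0"
  by (cases t) simp

lemma size_le_nvert_forest: "size G \<le> nvert_forest G"
proof (induction G)
  case (add t G)
  then show ?case using nvert_neq_0[of t] unfolding nvert_forest_def by (simp del: nvert_neq_0)
qed simp

lemma tree_coeff_Node:
  fixes F :: "'i::finite \<Rightarrow> ('i, 'k::field) mfps"
  shows "tree_coeff F (Node i G) = F i (image_mset root G) * prod_coeff F (image_mset root G) G"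
proof -
  let ?n = "nvert_forest G" and ?P = "\<lambda>\<alpha>. \<Prod>j\<in>#\<alpha>. dse_sol F j"
  \<comment> \<open>Every tree has a vertex, so a product with a non-zero component of degree
    \<open>?n\<close> has at most \<open>?n\<close> factors. With finitely many decorations,
    \<open>?A\<close> is a finite set containing all relevant exponents.\<close>
  let ?A = "\<Union>k\<le>?n. multisets_of_size (UNIV :: 'i set) k"
  have A: "\<alpha> \<in> ?A" if "fps_nth (?P \<alpha>) ?n \<noteq> 0" for \<alpha>
  proof -
    obtain H where H: "H \<in> Poly_Mapping.keys (fps_nth (?P \<alpha>) ?n)" using \<open>_ \<noteq> 0\<close> by fastforce
    have "size (image_mset root H) \<le> nvert_forest H" using size_le_nvert_forest by simp
    with keys_prod_dse_sol[OF H] show ?thesis by (auto simp: multisets_of_size_def)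
  qed
  have fin: "finite ?A" by auto
  have "tree_coeff F (Node i G) = Poly_Mapping.lookup (fps_nth (dse_sol F i) (Suc ?n)) {#Node i G#}"
    by (simp add: tree_coeff_def nvert_forest_def)
  also have "fps_nth (dse_sol F i) (Suc ?n) = fps_nth (dse_step F (dse_sol F) i) (Suc ?n)"
    by (subst dse_sol_fixpoint) simp
  also have "Poly_Mapping.lookup \<dots> {#Node i G#} =
      Poly_Mapping.lookup (Sum_any (\<lambda>\<alpha>. scale (F i \<alpha>) (fps_nth (?P \<alpha>) ?n))) G"
    by (simp add: dse_step_nth_Suc lookup_graft)
  also have "\<dots> = Poly_Mapping.lookup (\<Sum>\<alpha>\<in>?A. scale (F i \<alpha>) (fps_nth (?P \<alpha>) ?n)) G"
    using A by (subst Sum_any.expand_superset[OF fin]) (force simp: scale_def)+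
  also have "\<dots> = (\<Sum>\<alpha>\<in>?A. if \<alpha> = image_mset root G then F i \<alpha> * prod_coeff F \<alpha> G else 0)"
    using keys_prod_dse_sol[of G F _ ?n]
    by (auto simp: lookup_sum prod_coeff_def in_keys_iff intro!: sum.cong)
  also have "\<dots> = F i (image_mset root G) * prod_coeff F (image_mset root G) G"
    using size_le_nvert_forest[of G] by (subst sum.delta[OF fin]) (auto simp: multisets_of_size_def)
  finally show ?thesis .
qed

lemma finite_trees: "finite (trees (i :: 'i::finite) n)"
proof -
  \<comment> \<open>Bounding the size instead of fixing it suits the induction: the children of a
    tree have various smaller sizes.\<close>
  have "finite {t :: 'i rtree. nvert t \<le> n}" for n
  proof (induction n)
    case 0
    have "{t :: 'i rtree. nvert t \<le> 0} = {}" by auto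
    then show ?case by simp
  next
    case (Suc n)
    let ?B = "\<Union>k\<le>n. multisets_of_size {t :: 'i rtree. nvert t \<le> n} k"
    have "finite ((\<lambda>(i, G). Node i G) ` ((UNIV :: 'i set) \<times> ?B))"
      by (intro finite_imageI finite_cartesian_product finite_UN_I finite_multisets_of_size Suc) auto
    moreover have "{t :: 'i rtree. nvert t \<le> Suc n} \<subseteq> (\<lambda>(i, G). Node i G) ` (UNIV \<times> ?B)"
    proof
      fix t :: "'i rtree" assume t: "t \<in> {t. nvert t \<le> Suc n}"
      obtain i G where iG: "t = Node i G" by (cases t) auto
      have G: "nvert_forest G \<le> n" using t iG by (simp add: nvert_forest_def)
      have "nvert s \<le> n" if "s \<in># G" for s
        using G that unfolding nvert_forest_def
        by (metis (no_types) insert_DiffM image_mset_add_mset sum_mset.add_mset le_add1 le_trans)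
      moreover have "size G \<le> n" using size_le_nvert_forest[of G] G by simp
      ultimately show "t \<in> (\<lambda>(i, G). Node i G) ` (UNIV \<times> ?B)"
        unfolding iG by (auto simp: multisets_of_size_def)
    qed
    ultimately show ?case by (rule rev_finite_subset)
  qed
  from this[of n] show ?thesis by (rule rev_finite_subset) (auto simp: trees_def)
qed

section \<open>Removing leaves\<close>

text \<open>
  The trees obtained from \<open>t\<close> by removing a leaf \<open>k\<close>, with multiplicity. There is no empty tree, so
  the root is never removed.
\<close>

primrec prune :: "'i \<Rightarrow> 'i rtree \<Rightarrow> 'i rtree multiset" where
  "prune k (Node i ts) = (\<Sum>(t, r)\<in>#image_mset (\<lambda>t. (t, prune k t)) ts.
     (if t = Node k {#} then {#Node i (ts - {#t#})#} else {#}) +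
     image_mset (\<lambda>s. Node i (add_mset s (ts - {#t#}))) r)"

declare prune.simps [simp del]

text \<open>Primitive recursion reaches the children only through \<open>image_mset\<close>, so the
  defining equation pairs each child with its recursive value. Here the pairs are
  eliminated.\<close>

lemma prune_Node:
  "prune k (Node i ts) = (\<Sum>t\<in>#ts.
     (if t = Node k {#} then {#Node i (ts - {#t#})#} else {#}) +
     image_mset (\<lambda>s. Node i (add_mset s (ts - {#t#}))) (prune k t))"
  by (simp add: prune.simps image_mset.compositionality comp_def)

section \<open>Leaves and cuts in planar representatives\<close>

lemma vertices_PNode:
  "vertices (PNode i ps) = insert [] (\<Union>m<length ps. Cons m ` vertices (ps ! m))"
proof (rule set_eqI)
  fix v show "v \<in> vertices (PNode i ps) \<longleftrightarrow> v \<in> insert [] (\<Union>m<length ps. Cons m ` vertices (ps ! m))"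
    by (cases v) (auto simp: vertices_def image_iff)
qed

lemma finite_vertices [simp]: "finite (vertices p)"
  by (induction p) (auto simp: vertices_PNode)

lemma finite_leaves [simp]: "finite (leaves p)"
  by (simp add: leaves_def)

lemma finite_edges [simp]: "finite (edges p)"
  by (simp add: edges_def)

lemma map_upt_nth: "map (\<lambda>k. f (xs ! k)) [0..<length xs] = map f xs"
  by (rule nth_equalityI) simp_all

lemma root_component_empty: "root_component {} p = forget p"
proof (induction p)
  case (PNode i ps)
  have "map (\<lambda>k. root_component {} (ps ! k)) [0..<length ps] = map (\<lambda>k. forget (ps ! k)) [0..<length ps]"
    using PNode by auto
  also have "\<dots> = map forget ps"
    by (rule map_upt_nth)
  finally show ?case by simp
qed

text \<open>The address \<open>[]\<close> names no edge and \<open>root_component\<close> never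
  tests it. This cut arises when the component below a cut edge is computed.\<close>

lemma root_component_Nil: "root_component {[]} p = forget p"
  by (cases p) (simp add: root_component_empty[symmetric])

lemma mset_map_filter_upt:
  "mset (map g (filter P [0..<n])) = image_mset g (filter_mset P (mset_set {0..<n}))"
  by (simp add: mset_upt)

lemma root_component_singleton_Cons:
  assumes "m < length ps"
  shows "root_component {m # l} (PNode i ps) = Node i ((if l = [] then {#} else
     {#root_component {l} (ps ! m)#}) + (mset (map forget ps) - {#forget (ps ! m)#}))"
proof -
  let ?I = "{0..<length ps} - {m}"
  have I: "mset_set {0..<length ps} = add_mset m (mset_set ?I)"
    using assms by (intro mset_set.remove) auto
  have "map forget ps = map (\<lambda>k. forget (ps ! k)) [0..<length ps]"
    by (rule map_upt_nth[symmetric])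
  then have ps: "mset (map forget ps) = add_mset (forget (ps ! m)) (image_mset (\<lambda>k. forget (ps ! k)) (mset_set ?I))"
    by (simp only: mset_map mset_upt I image_mset_add_mset)
  \<comment> \<open>All children other than \<open>m\<close> receive the empty cut and remain
    unchanged.\<close>
  have I': "image_mset (\<lambda>k. root_component {w. k # w \<in> {m # l}} (ps ! k)) (mset_set ?I) =
      image_mset (\<lambda>k. forget (ps ! k)) (mset_set ?I)"
    by (rule image_mset_cong) (auto simp: root_component_empty)
  have "filter_mset (\<lambda>k. [k] \<notin> {m # l}) (mset_set {0..<length ps}) =
      (if l = [] then {#} else {#m#}) + mset_set ?I"
    unfolding I by (auto simp: filter_mset_eq_conv)
  then have "root_component {m # l} (PNode i ps) =
      Node i (image_mset (\<lambda>k. root_component {w. k # w \<in> {m # l}} (ps ! k))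
       ((if l = [] then {#} else {#m#}) + mset_set ?I))"
    unfolding root_component.simps mset_map_filter_upt by simp
  also have "\<dots> = Node i ((if l = [] then {#} else
     {#root_component {l} (ps ! m)#}) + (mset (map forget ps) - {#forget (ps ! m)#}))"
    unfolding image_mset_union I' ps by simp
  finally show ?thesis .
qed

lemma mset_set_UN_disjoint:
  assumes "finite I" "\<And>i. i \<in> I \<Longrightarrow> finite (A i)"
    and "\<And>i j. i \<in> I \<Longrightarrow> j \<in> I \<Longrightarrow> i \<noteq> j \<Longrightarrow> A i \<inter> A j = {}"
  shows "mset_set (\<Union>i\<in>I. A i) = (\<Sum>i\<in>I. mset_set (A i))"
  using assms
proof (induction I rule: finite_induct)
  case (insert i I)
  then have "A i \<inter> (\<Union>i\<in>I. A i) = {}" by fastforce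
  then show ?case using insert by (simp add: mset_set_Union)
qed simp

lemma image_mset_sum: "image_mset f (\<Sum>i\<in>I. A i) = (\<Sum>i\<in>I. image_mset f (A i))"
  by (induction I rule: infinite_finite_induct) auto

text \<open>The address \<open>[]\<close> belongs to this set for a one-vertex tree: it is not
  removable there, but it becomes a removable leaf once the tree is a child.\<close>

definition labelled_leaves :: "'i \<Rightarrow> 'i ptree \<Rightarrow> nat list set" where
  "labelled_leaves k p = {l \<in> leaves p. label_at p l = k}"

lemma finite_labelled_leaves [simp]: "finite (labelled_leaves k p)"
  by (simp add: labelled_leaves_def)

lemma Nil_in_labelled_leaves: "[] \<in> labelled_leaves k p \<longleftrightarrow> p = PNode k []"
  by (cases p) (auto simp: labelled_leaves_def leaves_def vertices_def label_at_def)

lemma labelled_leaves_PNode: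
  "labelled_leaves k (PNode i ps) - {[]} =
    (\<Union>m\<in>{..<length ps}. Cons m ` labelled_leaves k (ps ! m))"
proof (rule set_eqI)
  fix v
  show "v \<in> labelled_leaves k (PNode i ps) - {[]} \<longleftrightarrow>
      v \<in> (\<Union>m\<in>{..<length ps}. Cons m ` labelled_leaves k (ps ! m))"
    by (cases v) (auto simp: labelled_leaves_def leaves_def vertices_def label_at_def image_iff)
qed

lemma forget_eq_leaf [simp]: "forget p = Node k {#} \<longleftrightarrow> p = PNode k []"
  by (cases p) auto

text \<open>A removable leaf lies in a unique child. It is either the whole child, which then
  disappears, or a removable leaf of that child, to which the induction hypothesis applies. These
  are the two summands of \<open>prune_Node\<close>.\<close>

lemma image_root_component_leaves:
  "image_mset (\<lambda>l. root_component {l} p) (mset_set (labelled_leaves k p - {[]})) = prune k (forget p)"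
proof (induction p)
  case (PNode i ps)
  let ?TS = "mset (map forget ps)"
  define h where "h t = (if t = Node k {#} then {#Node i (?TS - {#t#})#} else {#}) +
     image_mset (\<lambda>s. Node i (add_mset s (?TS - {#t#}))) (prune k t)" for t
  have part: "image_mset (\<lambda>l. root_component {m # l} (PNode i ps)) (mset_set (labelled_leaves k (ps ! m))) =
      h (forget (ps ! m))" if m: "m < length ps" for m
  proof -
    let ?q = "ps ! m"
    let ?L = "labelled_leaves k ?q - {[]}"
    \<comment> \<open>The address \<open>[]\<close> is split off because the induction hypothesis
      excludes it.\<close>
    have L: "mset_set (labelled_leaves k ?q) = (if ?q = PNode k [] then {#[]#} else {#}) + mset_set ?L"
    proof (cases "?q = PNode k []")
      case True
      then have "mset_set (labelled_leaves k ?q) = add_mset [] (mset_set ?L)"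
        using Nil_in_labelled_leaves[of k ?q] by (intro mset_set.remove) auto
      then show ?thesis using True by simp
    next
      case False
      then show ?thesis using Nil_in_labelled_leaves[of k ?q] by simp
    qed
    have "image_mset (\<lambda>l. root_component {m # l} (PNode i ps)) (mset_set ?L) =
        image_mset (\<lambda>l. Node i (add_mset (root_component {l} ?q) (?TS - {#forget ?q#}))) (mset_set ?L)"
      using root_component_singleton_Cons[OF m] by (intro image_mset_cong) auto
    also have "\<dots> = image_mset (\<lambda>s. Node i (add_mset s (?TS - {#forget ?q#}))) (prune k (forget ?q))"
      using PNode.IH[of ?q] m by (simp add: image_mset.compositionality comp_def flip: PNode.IH)
    finally show ?thesis
      unfolding L h_def using root_component_singleton_Cons[OF m, of "[]" i] by simp
  qed
  have "image_mset (\<lambda>l. root_component {l} (PNode i ps)) (mset_set (labelled_leaves k (PNode i ps) - {[]})) =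
    (\<Sum>m<length ps. image_mset (\<lambda>l. root_component {l} (PNode i ps)) (mset_set (Cons m ` labelled_leaves k (ps ! m))))"
    unfolding labelled_leaves_PNode by (subst mset_set_UN_disjoint) (auto simp: image_mset_sum)
  also have "\<dots> = (\<Sum>m<length ps. image_mset (\<lambda>l. root_component {m # l} (PNode i ps)) (mset_set (labelled_leaves k (ps ! m))))"
    by (intro sum.cong refl) (simp add: image_mset_mset_set[symmetric] image_mset.compositionality comp_def)
  also have "\<dots> = (\<Sum>m<length ps. h (forget (ps ! m)))"
    using part by (intro sum.cong) auto
  also have "\<dots> = (\<Sum>t\<in>#?TS. h t)"
  proof -
    have "(\<Sum>t\<in>#?TS. h t) = sum_list (map h (map forget ps))"
      by (simp only: sum_mset_sum_list flip: mset_map)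
    then show ?thesis by (simp add: sum_list_sum_nth atLeast0LessThan)
  qed
  also have "\<dots> = prune k (forget (PNode i ps))" by (simp add: prune_Node h_def del: mset_map)
  finally show ?case .
qed

lemma count_image_mset_set:
  "finite A \<Longrightarrow> count (image_mset f (mset_set A)) x = card {a \<in> A. f a = x}"
  by (subst count_image_mset) (auto intro: arg_cong[where f = card])

lemma cut_trunk_eq: "cut_trunk p c = root_component c p"
  by (simp add: cut_trunk_def component_def)

lemma leaf_count_eq_count_prune: "leaf_count k t t' = count (prune k t) t'"
proof -
  let ?p = "planar t"
  have "{l \<in> leaves ?p \<inter> edges ?p. label_at ?p l = k \<and> cut_trunk ?p {l} = t'} =
      {l \<in> labelled_leaves k ?p - {[]}. root_component {l} ?p = t'}"
    by (auto simp: labelled_leaves_def leaves_def edges_def cut_trunk_eq)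
  then show ?thesis
    by (simp add: leaf_count_def forget_planar count_image_mset_set
        flip: image_root_component_leaves[of ?p k, unfolded forget_planar])
qed

lemma prune_root_nvert: "s \<in># prune k t \<Longrightarrow> root s = root t \<and> nvert t = Suc (nvert s)"
proof (induction t arbitrary: s)
  case (Node i ts)
  then obtain t where t: "t \<in># ts" "s \<in># (if t = Node k {#} then {#Node i (ts - {#t#})#} else {#}) +
     image_mset (\<lambda>s. Node i (add_mset s (ts - {#t#}))) (prune k t)"
    by (auto simp: prune_Node simp del: union_iff)
  have ts: "(\<Sum>t\<in>#ts. nvert t) = nvert t + (\<Sum>t\<in>#ts - {#t#}. nvert t)"
    using t(1) by (metis insert_DiffM image_mset_add_mset sum_mset.add_mset)
  show ?case using t(2) Node.IH[OF t(1)] by (auto simp: ts split: if_splits)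
qed

section \<open>Leaf removal as part of the coproduct\<close>

lemma finite_admissible [simp]: "finite {c. admissible p c}"
  by (rule finite_subset[of _ "Pow (edges p)"]) (auto simp: admissible_def)

text \<open>A cut has as many branches as edges, so a single leaf as branch forest comes from a
  one-edge cut above a leaf. The two primitive summands have an empty forest on one side and do not
  contribute.\<close>

lemma lookup_coprod_tree_leaf:
  "Poly_Mapping.lookup (coprod_tree t :: ('i, 'k::field) ck2) ({#Node j {#}#}, {#t'#}) =
    of_nat (leaf_count j t t')"
proof -
  let ?p = "planar t"
  let ?L = "{l \<in> leaves ?p \<inter> edges ?p. label_at ?p l = j \<and> cut_trunk ?p {l} = t'}"
  have component: "component {v} ?p v = forget (the (subtree_at v ?p))" for v
    by (simp add: component_def root_component_Nil)
  have single: "cut_branches ?p c = {#Node j {#}#} \<longleftrightarrow>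
      (\<exists>v. c = {v} \<and> the (subtree_at v ?p) = PNode j [])" for c
  proof
    assume c: "cut_branches ?p c = {#Node j {#}#}"
    then have "card c = 1" unfolding cut_branches_def by (metis size_image_mset size_mset_set size_single)
    then obtain v where "c = {v}" by (auto simp: card_1_singleton_iff)
    with c show "\<exists>v. c = {v} \<and> the (subtree_at v ?p) = PNode j []"
      by (simp add: cut_branches_def component)
  qed (auto simp: cut_branches_def component)
  have "{c. admissible ?p c \<and> cut_branches ?p c = {#Node j {#}#} \<and> cut_trunk ?p c = t'} =
      (\<lambda>v. {v}) ` ?L" (is "?A = _")
  proof (intro equalityI subsetI)
    fix c assume "c \<in> ?A"
    then obtain v where "c = {v}" "the (subtree_at v ?p) = PNode j []" "v \<in> edges ?p"
        "cut_trunk ?p {v} = t'"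
      unfolding single by (auto simp: admissible_def)
    then show "c \<in> (\<lambda>v. {v}) ` ?L" by (auto simp: leaves_def edges_def label_at_def)
  next
    fix c assume "c \<in> (\<lambda>v. {v}) ` ?L"
    then obtain v where v: "c = {v}" "v \<in> ?L" by blast
    have "the (subtree_at v ?p) = PNode j []"
      using v(2) by (cases "the (subtree_at v ?p)") (auto simp: leaves_def label_at_def)
    \<comment> \<open>A one-edge cut meets every path at most once, hence is admissible.\<close>
    moreover have "card ({v} \<inter> E) \<le> 1" for E :: "nat list set"
      using card_mono[of "{v}" "{v} \<inter> E"] by simp
    ultimately show "c \<in> ?A" using v unfolding single by (auto simp: admissible_def)
  qed
  then have "card ?A = leaf_count j t t'"
    by (simp add: leaf_count_def card_image)
  moreover have "Poly_Mapping.lookup (coprod_tree t :: ('i, 'k) ck2) ({#Node j {#}#}, {#t'#}) =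
      (\<Sum>c | admissible ?p c. if cut_branches ?p c = {#Node j {#}#} \<and> cut_trunk ?p c = t' then 1 else 0)"
    by (auto simp: coprod_tree_def lookup_add lookup_sum lookup_monom lookup_one intro!: sum.cong)
  moreover have "\<dots> = of_nat (card ?A)"
    by (subst sum.inter_filter[symmetric]) simp_all
  ultimately show ?thesis by simp
qed

section \<open>The structure coefficients of a Hopf system\<close>

lemma lookup_coprod_dse_sol:
  fixes F :: "'i::finite \<Rightarrow> ('i, 'k::field) mfps"
  shows "Poly_Mapping.lookup (coprod (fps_nth (dse_sol F i) n)) u =
    (\<Sum>t\<in>trees i n. tree_coeff F t * Poly_Mapping.lookup (coprod_tree t) u)"
proof -
  let ?x = "fps_nth (dse_sol F i) n"
  have "Poly_Mapping.lookup (coprod ?x) u = (\<Sum>G\<in>Poly_Mapping.keys ?x.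
      Poly_Mapping.lookup ?x G * Poly_Mapping.lookup (\<Prod>t\<in>#G. coprod_tree t) u)"
    by (simp add: coprod_def lookup_lin_ext)
  also have "\<dots> = (\<Sum>G\<in>(\<lambda>t. {#t#}) ` trees i n.
      Poly_Mapping.lookup ?x G * Poly_Mapping.lookup (\<Prod>t\<in>#G. coprod_tree t) u)"
    by (rule sum.mono_neutral_left) (auto simp: finite_trees in_keys_iff dest: keys_dse_sol)
  also have "\<dots> = (\<Sum>t\<in>trees i n. tree_coeff F t * Poly_Mapping.lookup (coprod_tree t) u)"
    by (subst sum.reindex) (auto simp: inj_on_def lookup_dse_sol intro!: sum.cong)
  finally show ?thesis .
qed

text \<open>A Leibniz rule: reading off the coefficient of a single tree is a derivation relative to
  the counit.\<close>

lemma lookup_mult_at_singleton: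
  fixes f g :: "('a multiset, 'k::field) poly_mapping"
  shows "Poly_Mapping.lookup (f * g) {#t#} =
    Poly_Mapping.lookup f {#} * Poly_Mapping.lookup g {#t#} +
    Poly_Mapping.lookup f {#t#} * Poly_Mapping.lookup g {#}"
proof -
  have "{#t#} = l + q \<longleftrightarrow> l = {#} \<and> q = {#t#} \<or> l = {#t#} \<and> q = {#}" for l q :: "'a multiset"
    by (auto simp: single_is_union)
  then have "(\<Sum>q. Poly_Mapping.lookup g q when {#t#} = l + q) =
      (if l = {#} then Poly_Mapping.lookup g {#t#} else if l = {#t#} then Poly_Mapping.lookup g {#} else 0)" for l
    by (simp add: when_def)
  then have "Poly_Mapping.lookup (f * g) {#t#} = Sum_any (\<lambda>l. Poly_Mapping.lookup f l *
      (if l = {#} then Poly_Mapping.lookup g {#t#} else if l = {#t#} then Poly_Mapping.lookup g {#} else 0))"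
    by (simp add: lookup_mult)
  also have "\<dots> = (\<Sum>l\<in>{{#}, {#t#}}. Poly_Mapping.lookup f l *
      (if l = {#} then Poly_Mapping.lookup g {#t#} else if l = {#t#} then Poly_Mapping.lookup g {#} else 0))"
    by (rule Sum_any.expand_superset) auto
  finally show ?thesis by simp
qed

lemma dse_algebra_proportional:
  assumes "f \<in> dse_algebra F"
  shows "\<exists>l. \<forall>t\<in>trees i n. Poly_Mapping.lookup f {#t#} = l * tree_coeff F t"
proof -
  interpret module scale by (rule module_scale)
  define S where "S = {f. \<exists>l. \<forall>t\<in>trees i n. Poly_Mapping.lookup f {#t#} = l * tree_coeff F t}"
  have "subspace S"
  proof (rule subspaceI)
    show "0 \<in> S" unfolding S_def by (auto intro: exI[of _ 0])
    show "x + y \<in> S" if xy: "x \<in> S" "y \<in> S" for x y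
    proof -
      obtain a b where "\<forall>t\<in>trees i n. Poly_Mapping.lookup x {#t#} = a * tree_coeff F t"
          "\<forall>t\<in>trees i n. Poly_Mapping.lookup y {#t#} = b * tree_coeff F t"
        using xy unfolding S_def by blast
      then show ?thesis unfolding S_def
        by (auto intro!: exI[of _ "a + b"] simp: lookup_add distrib_right)
    qed
    show "scale c x \<in> S" if xy: "x \<in> S" for c x
    proof -
      obtain a where "\<forall>t\<in>trees i n. Poly_Mapping.lookup x {#t#} = a * tree_coeff F t"
        using xy unfolding S_def by blast
      then show ?thesis unfolding S_def by (auto intro!: exI[of _ "c * a"])
    qed
  qed
  moreover have "1 \<in> S" unfolding S_def by (auto intro: exI[of _ 0] simp: lookup_one)
  moreover have "x * y \<in> S" if xy: "x \<in> S" "y \<in> S" for x y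
  proof -
    obtain a b where "\<forall>t\<in>trees i n. Poly_Mapping.lookup x {#t#} = a * tree_coeff F t"
        "\<forall>t\<in>trees i n. Poly_Mapping.lookup y {#t#} = b * tree_coeff F t"
      using xy unfolding S_def by blast
    then show ?thesis unfolding S_def
      \<comment> \<open>The factor given by the Leibniz rule does not depend on the tree.\<close>
      by (auto intro!: exI[of _ "Poly_Mapping.lookup x {#} * b + a * Poly_Mapping.lookup y {#}"]
          simp: lookup_mult_at_singleton algebra_simps)
  qed
  ultimately have "subalgebra S" by (simp add: subalgebra_def)
  moreover have "fps_nth (dse_sol F k) m \<in> S" for k m
    \<comment> \<open>The trees of a generator lie in \<open>trees k m\<close>, which is disjoint
      from \<open>trees i n\<close> unless the indices agree; so the factor is 1 or 0.\<close>
    unfolding S_def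
    by (auto intro!: exI[of _ "if k = i \<and> m = n then 1 else 0"] simp: lookup_dse_sol) (auto simp: trees_def)
  ultimately have "dse_algebra F \<subseteq> S"
    unfolding dse_algebra_def by (intro hull_minimal) auto
  with assms show ?thesis by (auto simp: S_def)
qed

lemma hopf_dse_structure_coefficient:
  fixes F :: "'i::finite \<Rightarrow> ('i, 'k::field) mfps"
  assumes "hopf_dse F"
  shows "\<exists>l. \<forall>t'\<in>trees i n.
    (\<Sum>t\<in>trees i (Suc n). of_nat (leaf_count j t t') * tree_coeff F t) = l * tree_coeff F t'"
proof -
  interpret ck2: module "scale :: 'k \<Rightarrow> ('i, 'k) ck2 \<Rightarrow> _" by (rule module_scale)
  let ?x = "fps_nth (dse_sol F i) (Suc n)" and ?leaf = "{#Node j {#}#}"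
  \<comment> \<open>\<open>Q\<close> imposes proportionality on the right factor next to a leaf
    \<open>j\<close> on the left. Being a subspace that contains the tensors of
    \<open>dse_algebra F\<close>, it contains the coproduct of \<open>?x\<close>, whose coefficients
    there count leaf removals.\<close>
  define Q :: "('i, 'k) ck2 set" where
    "Q = {w. \<exists>l. \<forall>t\<in>trees i n. Poly_Mapping.lookup w (?leaf, {#t#}) = l * tree_coeff F t}"
  have "ck2.subspace Q"
  proof (rule ck2.subspaceI)
    show "0 \<in> Q" unfolding Q_def by (auto intro: exI[of _ 0])
    show "x + y \<in> Q" if xy: "x \<in> Q" "y \<in> Q" for x y
    proof -
      obtain a b where "\<forall>t\<in>trees i n. Poly_Mapping.lookup x (?leaf, {#t#}) = a * tree_coeff F t"
          "\<forall>t\<in>trees i n. Poly_Mapping.lookup y (?leaf, {#t#}) = b * tree_coeff F t"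
        using xy unfolding Q_def by blast
      then show ?thesis unfolding Q_def
        by (auto intro!: exI[of _ "a + b"] simp: lookup_add distrib_right)
    qed
    show "scale c x \<in> Q" if xy: "x \<in> Q" for c x
    proof -
      obtain a where "\<forall>t\<in>trees i n. Poly_Mapping.lookup x (?leaf, {#t#}) = a * tree_coeff F t"
        using xy unfolding Q_def by blast
      then show ?thesis unfolding Q_def by (auto intro!: exI[of _ "c * a"])
    qed
  qed
  moreover have "tensor x y \<in> Q" if y: "y \<in> dse_algebra F" for x y
  proof -
    obtain a where "\<forall>t\<in>trees i n. Poly_Mapping.lookup y {#t#} = a * tree_coeff F t"
      using dse_algebra_proportional[OF y] by blast
    then show ?thesis unfolding Q_def
      by (auto intro!: exI[of _ "Poly_Mapping.lookup x ?leaf * a"])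
  qed
  ultimately have "ck2.span {tensor x y | x y. x \<in> dse_algebra F \<and> y \<in> dse_algebra F} \<subseteq> Q"
    by (intro ck2.span_minimal) auto
  moreover have "?x \<in> dse_algebra F"
    unfolding dse_algebra_def by (rule hull_inc) auto
  ultimately have "coprod ?x \<in> Q"
    using assms unfolding hopf_dse_def hopf_subalgebra_def by blast
  then obtain l where l: "\<forall>t\<in>trees i n. Poly_Mapping.lookup (coprod ?x) (?leaf, {#t#}) = l * tree_coeff F t"
    unfolding Q_def by blast
  then show ?thesis
    by (auto simp: lookup_coprod_dse_sol lookup_coprod_tree_leaf mult.commute intro!: exI[of _ l])
qed

section \<open>Coefficients of corollas and of trees with few branches\<close>

abbreviation leaf :: "'i \<Rightarrow> 'i rtree" where
  "leaf j \<equiv> Node j {#}"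

abbreviation corolla :: "'i \<Rightarrow> 'i multiset \<Rightarrow> 'i rtree" where
  "corolla i \<alpha> \<equiv> Node i (image_mset leaf \<alpha>)"

lemma count_image_inj: "inj f \<Longrightarrow> count (image_mset f M) (f x) = count M x"
  by (induction M) (auto simp: inj_eq)

lemma prune_leaf [simp]: "prune k (leaf i) = {#}"
  by (simp add: prune_Node)

lemma in_prune_Node:
  "Node i ts' \<in># prune k (Node i ts) \<longleftrightarrow>
    ts = add_mset (leaf k) ts' \<or>
    (\<exists>t s us. ts = add_mset t us \<and> ts' = add_mset s us \<and> s \<in># prune k t)"
  (is "?l \<longleftrightarrow> ?r")
proof
  assume ?l
  then obtain t where t: "t \<in># ts" "Node i ts' \<in># (if t = leaf k then {#Node i (ts - {#t#})#} else {#}) +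
     image_mset (\<lambda>s. Node i (add_mset s (ts - {#t#}))) (prune k t)"
    by (auto simp: prune_Node simp del: union_iff)
  then show ?r by (cases "t = leaf k") (auto dest: multi_member_split)
next
  assume ?r
  then show ?l
  proof (elim disjE exE conjE)
    fix t s us assume "ts = add_mset t us" "ts' = add_mset s us" "s \<in># prune k t"
    then show ?l by (auto simp: prune_Node intro!: bexI[of _ t] bexI[of _ s])
  qed (simp add: prune_Node)
qed

lemma tree_coeff_leaf [simp]:
  fixes F :: "'i::finite \<Rightarrow> ('i, 'k::field) mfps"
  shows "F i {#} = 1 \<Longrightarrow> tree_coeff F (leaf i) = 1"
  by (simp add: tree_coeff_Node)

lemma prod_coeff_single [simp]: "prod_coeff F {#root u#} {#u#} = tree_coeff F u"
proof -
  have "{t. t = u \<and> root t = root u} = {u}" by auto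
  then show ?thesis by (simp add: prod_coeff_add_mset)
qed

lemma tree_coeff_Node_single:
  fixes F :: "'i::finite \<Rightarrow> ('i, 'k::field) mfps"
  shows "tree_coeff F (Node i {#u#}) = F i {#root u#} * tree_coeff F u"
  by (simp add: tree_coeff_Node)

text \<open>Repeated decorations produce no multiplicity: the recursion sums over distinct trees,
  and \<open>leaf j\<close> is the only one here with root \<open>j\<close>.\<close>

lemma prod_coeff_leaves:
  fixes F :: "'i::finite \<Rightarrow> ('i, 'k::field) mfps"
  assumes "\<And>l. F l {#} = 1"
  shows "prod_coeff F \<alpha> (image_mset leaf \<alpha>) = 1"
proof (induction \<alpha>)
  case (add j \<alpha>)
  have "{t. t \<in># image_mset leaf (add_mset j \<alpha>) \<and> root t = j} = {leaf j}" by auto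
  then show ?case using add assms by (simp add: prod_coeff_add_mset)
qed simp

lemma tree_coeff_corolla:
  fixes F :: "'i::finite \<Rightarrow> ('i, 'k::field) mfps"
  assumes "\<And>l. F l {#} = 1"
  shows "tree_coeff F (corolla i \<alpha>) = F i \<alpha>"
  using prod_coeff_leaves[of F \<alpha>, OF assms]
  by (simp add: tree_coeff_Node image_mset.compositionality comp_def)

text \<open>The factor 2 has two sources. If \<open>u\<close> is the leaf \<open>k\<close>, either
  of two equal leaves can be removed; if \<open>u\<close> is a bigger tree with root
  \<open>k\<close>, then \<open>u\<close> and the leaf can be drawn from the two equal factors in
  either order.\<close>

lemma tree_coeff_Node_leaf:
  fixes F :: "'i::finite \<Rightarrow> ('i, 'k::field) mfps"
  assumes "\<And>l. F l {#} = 1"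
  shows "of_nat (count (prune k (Node i {#u, leaf k#})) (Node i {#u#})) * tree_coeff F (Node i {#u, leaf k#}) =
    (if root u = k then 2 else 1) * F i {#k, root u#} * tree_coeff F u"
proof (cases "u = leaf k")
  case True
  have "{t. t = leaf k \<and> root t = k} = {leaf k}" by auto
  then show ?thesis using assms True by (simp add: tree_coeff_Node prod_coeff_add_mset prune_Node)
next
  case False
  have "count (prune k (Node i {#u, leaf k#})) (Node i {#u#}) = 1"
    using False by (auto simp: prune_Node not_in_iff[symmetric] add_eq_conv_ex)
  moreover have "prod_coeff F {#k, root u#} {#u, leaf k#} = (if root u = k then 2 else 1) * tree_coeff F u"
  proof -
    have "{t. (t = u \<or> t = leaf k) \<and> root t = k} = (if root u = k then {u, leaf k} else {leaf k})" by auto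
    moreover have "{#u, leaf k#} - {#leaf k#} = {#u#}" by (simp add: add_mset_commute)
    moreover have "prod_coeff F {#k#} {#leaf k#} = 1"
      using assms prod_coeff_single[of F "leaf k"] by simp
    ultimately show ?thesis using False assms
      using prod_coeff_single[of F u] by (auto simp: prod_coeff_add_mset[of F k "{#root u#}"])
  qed
  ultimately show ?thesis by (simp add: tree_coeff_Node add_mset_commute)
qed

section \<open>Levels\<close>

text \<open>
  Adding a leaf to a corolla at a vertex other than the root keeps the decorations of the children
  of the root, so all trees but the bigger corolla contribute a multiple of \<open>F i \<alpha>\<close>.
\<close>

lemma hopf_coeff_add_mset_eq_0:
  fixes F :: "'i::finite \<Rightarrow> ('i, 'k::field_char_0) mfps"
  assumes F1: "\<And>l. F l {#} = 1" and "hopf_dse F" and 0: "F i \<alpha> = 0"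
  shows "F i (add_mset k \<alpha>) = 0"
proof -
  let ?t' = "corolla i \<alpha>" and ?t = "corolla i (add_mset k \<alpha>)"
  let ?n = "nvert ?t'"
  have t': "?t' \<in> trees i ?n" by (simp add: trees_def)
  have t: "?t \<in> trees i (Suc ?n)" by (simp add: trees_def)
  have zero: "count (prune k t) ?t' = 0 \<or> tree_coeff F t = 0" if tt: "t \<in> trees i (Suc ?n)" "t \<noteq> ?t" for t
  proof (rule disjCI)
    assume "tree_coeff F t \<noteq> 0"
    moreover obtain ts where ts: "t = Node i ts" using tt(1) by (cases t) (auto simp: trees_def)
    ultimately have "F i (image_mset root ts) \<noteq> 0" by (simp add: tree_coeff_Node)
    with 0 have neq: "image_mset root ts \<noteq> \<alpha>" by auto
    have "ts \<noteq> add_mset (leaf k) (image_mset leaf \<alpha>)" using tt(2) ts by simp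
    moreover have False if "ts = add_mset s us" "image_mset leaf \<alpha> = add_mset r us" "r \<in># prune k s" for r s us
    proof -
      have "image_mset root ts = image_mset root (image_mset leaf \<alpha>)"
        using that prune_root_nvert[OF that(3)] by simp
      then show False using neq by (simp add: image_mset.compositionality comp_def)
    qed
    ultimately show "count (prune k t) ?t' = 0"
      unfolding ts count_eq_zero_iff in_prune_Node by blast
  qed
  \<comment> \<open>Whatever \<open>l\<close> is, it multiplies the coefficient of the corolla,
    which is \<open>F i \<alpha> = 0\<close>.\<close>
  obtain l where "(\<Sum>t\<in>trees i (Suc ?n). of_nat (leaf_count k t ?t') * tree_coeff F t) = l * tree_coeff F ?t'"
    using hopf_dse_structure_coefficient[OF \<open>hopf_dse F\<close>] t' by blast
  also have "\<dots> = 0" using 0 by (simp add: tree_coeff_corolla[of F, OF F1])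
  also have "(\<Sum>t\<in>trees i (Suc ?n). of_nat (leaf_count k t ?t') * tree_coeff F t) =
      (\<Sum>t\<in>{?t}. of_nat (count (prune k t) ?t') * tree_coeff F t)"
    unfolding leaf_count_eq_count_prune
  proof (intro sum.mono_neutral_right finite_trees ballI)
    show "of_nat (count (prune k t) ?t') * tree_coeff F t = 0" if "t \<in> trees i (Suc ?n) - {?t}" for t
      using zero[of t] that by auto
  qed (use t in blast)
  finally have "of_nat (count (prune k ?t) ?t') * F i (add_mset k \<alpha>) = (0 :: 'k)"
    by (simp only: tree_coeff_corolla[of F, OF F1] sum.insert sum.empty finite.emptyI empty_iff
        not_False_eq_True add_0_right)
  \<comment> \<open>The count is positive and can be cancelled in characteristic zero.\<close>
  moreover have "?t' \<in># prune k ?t" by (simp add: in_prune_Node)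
  ultimately show ?thesis by (simp add: count_eq_zero_iff)
qed

text \<open>Any exponent containing \<open>j\<close> arises from \<open>{#j#}\<close> by adding
  elements, and vanishing persists along the way. Direct descendants are thus detected by linear
  coefficients.\<close>

lemma hopf_coeff_single_neq_0:
  fixes F :: "'i::finite \<Rightarrow> ('i, 'k::field_char_0) mfps"
  assumes "\<And>l. F l {#} = 1" "hopf_dse F" "F i \<alpha> \<noteq> 0" "j \<in># \<alpha>"
  shows "F i {#j#} \<noteq> 0"
proof
  assume 0: "F i {#j#} = 0"
  have "F i ({#j#} + \<beta>) = 0" for \<beta>
    by (induction \<beta>) (use 0 hopf_coeff_add_mset_eq_0[of F i] assms in auto)
  then have "F i \<alpha> = 0" using assms(4) by (metis insert_DiffM add_mset_add_single union_commute)
  with assms(3) show False by simp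
qed

section \<open>Structure coefficients along an edge of the graph\<close>

locale hopf_system =
  fixes F :: "'i::finite \<Rightarrow> ('i, 'k::field_char_0) mfps"
  assumes nonconst: "\<And>l. nonconstant (F l)"
    and one: "\<And>l. F l {#} = 1"
    and hopf: "hopf_dse F"
begin

text \<open>As \<open>F i\<close> is not constant, some linear coefficient is non-zero, so a ladder
  can always be prolonged. This makes \<open>lambda\<close> unique and supplies test trees.\<close>

lemma ex_tree_coeff_neq_0: "n \<ge> 1 \<Longrightarrow> \<exists>t\<in>trees i n. tree_coeff F t \<noteq> 0"
proof (induction n arbitrary: i)
  case (Suc n)
  show ?case
  proof (cases "n = 0")
    case True
    then show ?thesis by (intro bexI[of _ "leaf i"]) (auto simp: one trees_def)
  next
    case False
    obtain \<alpha> where "\<alpha> \<noteq> {#}" "F i \<alpha> \<noteq> 0" using nonconst unfolding nonconstant_def by blast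
    then obtain j where j: "F i {#j#} \<noteq> 0"
      using hopf_coeff_single_neq_0[of F, OF one hopf] by (metis multiset_nonemptyE)
    from Suc.IH[of j] False obtain t where "t \<in> trees j n" "tree_coeff F t \<noteq> 0" by auto
    with j show ?thesis
      by (intro bexI[of _ "Node i {#t#}"]) (auto simp: trees_def tree_coeff_Node_single)
  qed
qed simp

lemma lambda:
  assumes "n \<ge> 1" "t' \<in> trees i n"
  shows "(\<Sum>t\<in>trees i (Suc n). of_nat (count (prune j t) t') * tree_coeff F t) =
    lambda F i j n * tree_coeff F t'"
proof -
  let ?P = "\<lambda>l. \<forall>t'\<in>trees i n.
     (\<Sum>t\<in>trees i (Suc n). of_nat (leaf_count j t t') * tree_coeff F t) = l * tree_coeff F t'"
  have "\<exists>!l. ?P l"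
  proof (rule ex_ex1I)
    show "\<exists>l. ?P l" by (rule hopf_dse_structure_coefficient[OF hopf])
    fix l m assume "?P l" "?P m"
    moreover obtain t where "t \<in> trees i n" "tree_coeff F t \<noteq> 0"
      using ex_tree_coeff_neq_0 assms(1) by blast
    ultimately show "l = m" by (metis mult_right_cancel)
  qed
  then have "?P (lambda F i j n)" unfolding lambda_def by (rule theI')
  with assms(2) show ?thesis by (simp add: leaf_count_eq_count_prune)
qed

lemma lambda_Suc:
  assumes j: "F i {#j#} \<noteq> 0" and n: "n \<ge> 1"
  shows "lambda F i k (Suc n) =
    (if j = k then 2 else 1) * F i {#k, j#} / F i {#j#} + lambda F j k n"
proof -
  obtain u where u: "u \<in> trees j n" "tree_coeff F u \<noteq> 0" using ex_tree_coeff_neq_0 n by blast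
  then have root: "root u = j" by (simp add: trees_def)
  let ?t' = "Node i {#u#}" and ?t = "Node i {#u, leaf k#}" and ?N = "\<lambda>s. Node i {#s#}"
  let ?f = "\<lambda>t. of_nat (count (prune k t) ?t') * tree_coeff F t"
  have t': "?t' \<in> trees i (Suc n)" using u(1) by (simp add: trees_def)
  have coeff_t': "tree_coeff F ?t' = F i {#j#} * tree_coeff F u"
    by (simp add: tree_coeff_Node_single root)
  have sub: "insert ?t (?N ` trees j (Suc n)) \<subseteq> trees i (Suc (Suc n))"
    using u(1) by (auto simp: trees_def)
  \<comment> \<open>A tree that prunes to \<open>?t'\<close> carries the extra leaf either at the
    root, giving \<open>?t\<close>, or inside the branch, giving some \<open>?N s\<close>.\<close>
  have zero: "?f t = 0" if t: "t \<in> trees i (Suc (Suc n))" "t \<notin> insert ?t (?N ` trees j (Suc n))" for t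
  proof -
    obtain ts where ts: "t = Node i ts" using t(1) by (cases t) (auto simp: trees_def)
    have "?t' \<notin># prune k t"
    proof
      assume prune: "?t' \<in># prune k t"
      then consider "ts = {#leaf k, u#}" | s where "ts = {#s#}" "u \<in># prune k s"
        unfolding ts in_prune_Node by auto
      then show False
      proof cases
        case 2
        then have "s \<in> trees j (Suc n)" using prune_root_nvert[of u k s] u(1) by (simp add: trees_def)
        then show False using t(2) ts 2 by blast
      qed (use t(2) ts in \<open>simp add: add_mset_commute\<close>)
    qed
    then show ?thesis by (simp add: not_in_iff)
  qed
  have count: "count (prune k (?N s)) ?t' = count (prune k s) u" for s
  proof -
    have "count (image_mset ?N (prune k s)) ?t' = count (prune k s) u"
      by (rule count_image_inj) (auto simp: inj_on_def)
    then show ?thesis by (simp add: prune_Node)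
  qed
  have "lambda F i k (Suc n) * tree_coeff F ?t' = (\<Sum>t\<in>trees i (Suc (Suc n)). ?f t)"
    using lambda[OF _ t', of k] by simp
  also have "\<dots> = (\<Sum>t\<in>insert ?t (?N ` trees j (Suc n)). ?f t)"
    using zero by (intro sum.mono_neutral_right finite_trees sub) auto
  also have "\<dots> = ?f ?t + (\<Sum>t\<in>?N ` trees j (Suc n). ?f t)"
    by (subst sum.insert) (auto simp: finite_trees)
  also have "(\<Sum>t\<in>?N ` trees j (Suc n). ?f t) = (\<Sum>s\<in>trees j (Suc n). ?f (?N s))"
    by (subst sum.reindex) (auto simp: inj_on_def)
  also have "\<dots> = F i {#j#} * (\<Sum>s\<in>trees j (Suc n). of_nat (count (prune k s) u) * tree_coeff F s)"
    unfolding sum_distrib_left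
    by (intro sum.cong refl) (auto simp: count tree_coeff_Node_single trees_def)
  also have "\<dots> = F i {#j#} * (lambda F j k n * tree_coeff F u)"
    using lambda[OF n u(1), of k] by simp
  also have "?f ?t = (if j = k then 2 else 1) * F i {#k, j#} * tree_coeff F u"
    using tree_coeff_Node_leaf[of F k i u, OF one] by (simp add: root)
  finally have "lambda F i k (Suc n) * F i {#j#} * tree_coeff F u =
      ((if j = k then 2 else 1) * F i {#k, j#} + lambda F j k n * F i {#j#}) * tree_coeff F u"
    unfolding coeff_t' by (simp only: algebra_simps)
  then have "lambda F i k (Suc n) * F i {#j#} =
      (if j = k then 2 else 1) * F i {#k, j#} + lambda F j k n * F i {#j#}"
    unfolding mult_right_cancel[OF u(2)] .
  from arg_cong[OF this, of "\<lambda>x. x / F i {#j#}"] j show ?thesis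
    by (simp only: add_divide_distrib nonzero_mult_div_cancel_right not_False_eq_True)
qed

text \<open>The slope \<open>b\<close> is fixed on both sides, so the equivalence transfers levels
  and slopes at once.\<close>

lemma lambda_affine_iff:
  assumes j: "F i {#j#} \<noteq> 0"
  shows "(\<exists>a. \<forall>n>Suc M. lambda F i k n = b * (of_nat n - 1) + a) \<longleftrightarrow>
    (\<exists>a. \<forall>n>M. lambda F j k n = b * (of_nat n - 1) + a)"
proof -
  define C where "C = (if j = k then 2 else 1) * F i {#k, j#} / F i {#j#}"
  \<comment> \<open>Here \<open>n > M\<close> guarantees \<open>n \<ge> 1\<close>, as
    \<open>lambda_Suc\<close> requires.\<close>
  have step: "lambda F i k (Suc n) = C + lambda F j k n" if "n > M" for n
    unfolding C_def using that by (intro lambda_Suc[OF j]) simp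
  have shift: "(\<forall>n>Suc M. P n) \<longleftrightarrow> (\<forall>n>M. P (Suc n))" for P
    by (metis Suc_less_eq Suc_less_SucD Suc_lessE)
  \<comment> \<open>Raising the index by one adds \<open>b\<close>, so the intercepts correspond by
    the bijection sending \<open>a\<close> to \<open>a + b - C\<close>.\<close>
  have "(\<forall>n>Suc M. lambda F i k n = b * (of_nat n - 1) + a) \<longleftrightarrow>
      (\<forall>n>M. lambda F j k n = b * (of_nat n - 1) + (a + b - C))" for a
    unfolding shift using step by (simp add: algebra_simps)
  moreover have "\<exists>a. a' = a + b - C" for a' by (rule exI[of _ "a' - b + C"]) simp
  ultimately show ?thesis by metis
qed

lemma level_le_Suc_iff:
  assumes "F i {#j#} \<noteq> 0"
  shows "level_le F (Suc M) i \<longleftrightarrow> level_le F M j"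
  unfolding level_le_def using lambda_affine_iff[OF assms] by simp

end

section \<open>Uniqueness of slopes and comparison of levels\<close>

lemma level_le_mono: "level_le F M i \<Longrightarrow> M \<le> N \<Longrightarrow> level_le F N i"
  unfolding level_le_def by (meson le_less_trans)

text \<open>The slope is the difference of two consecutive values beyond both thresholds.\<close>

lemma affine_slope_unique:
  fixes b b' :: "'k::field_char_0"
  assumes "\<forall>n>M. f n = b * (of_nat n - 1) + a" "\<forall>n>N. f n = b' * (of_nat n - 1) + a'"
  shows "b = b'"
proof -
  define n where "n = Suc (max M N)"
  have "b * (of_nat n - 1) + a = b' * (of_nat n - 1) + a'"
      "b * (of_nat (Suc n) - 1) + a = b' * (of_nat (Suc n) - 1) + a'"
    using assms[THEN spec, of n] assms[THEN spec, of "Suc n"] by (auto simp: n_def)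
  moreover have "c = (c * (of_nat (Suc n) - 1) + d) - (c * (of_nat n - 1) + d)" for c d :: 'k
    by (simp add: algebra_simps)
  ultimately show ?thesis by metis
qed

text \<open>\<open>level_slope\<close> refers to the exact level; this computes it from any
  threshold \<open>N\<close>.\<close>

lemma level_slope_eq:
  fixes F :: "'i \<Rightarrow> ('i, 'k::field_char_0) mfps"
  assumes "finite_level F i" "\<forall>n>N. lambda F i k n = b * (of_nat n - 1) + a"
  shows "level_slope F i k = b"
proof -
  obtain M where M: "has_level F i M" using assms(1) by (auto simp: finite_level_def)
  then obtain b' a' where b': "\<forall>n>M. lambda F i k n = b' * (of_nat n - 1) + a'"
    unfolding has_level_def level_le_def by blast
  show ?thesis unfolding level_slope_def
  proof (rule the_equality)
    show "\<exists>M a. has_level F i M \<and> (\<forall>n>M. lambda F i k n = b * (of_nat n - 1) + a)"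
      using M b' affine_slope_unique[OF b' assms(2)] by blast
    show "c = b" if "\<exists>M a. has_level F i M \<and> (\<forall>n>M. lambda F i k n = c * (of_nat n - 1) + a)" for c
      using that affine_slope_unique[OF _ assms(2)] by blast
  qed
qed

theorem proposition23:
  fixes F :: "'i::finite \<Rightarrow> ('i, 'k::field_char_0) mfps"
    and i j :: 'i
  assumes "\<And>l. nonconstant (F l)"
    and "\<And>l. F l {#} = 1"
    and "hopf_dse F"
    and "direct_descendant F i j"
  shows "((has_level F i 0 \<or> has_level F i 1) \<longleftrightarrow> has_level F j 0) \<and>
         (\<forall>M\<ge>2. has_level F i M \<longleftrightarrow> has_level F j (M - 1)) \<and>
         (finite_level F i \<and> finite_level F j \<longrightarrow>
            (\<forall>k. level_slope F i k = level_slope F j k))"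
proof -
  interpret hopf_system F by unfold_locales (rule assms)+
  obtain \<alpha> where "F i (add_mset j \<alpha>) \<noteq> 0"
    using assms(4) by (auto simp: direct_descendant_def mfps_deriv_def fun_eq_iff)
  then have ij: "F i {#j#} \<noteq> 0"
    by (rule hopf_coeff_single_neq_0[of F, OF one hopf]) simp
  note level = level_le_Suc_iff[OF ij]
  \<comment> \<open>Level 0 or 1 together means level at most 1, which corresponds to level at most
    0 of \<open>j\<close>.\<close>
  have "(has_level F i 0 \<or> has_level F i 1) \<longleftrightarrow> has_level F j 0"
    using level[of 0] level_le_mono[of F 0 i 1] by (auto simp: has_level_def)
  moreover have "has_level F i M \<longleftrightarrow> has_level F j (M - 1)" if M: "M \<ge> 2" for M
  proof -
    \<comment> \<open>Now \<open>M\<close> and \<open>M - 1\<close> are both successors, so the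
      shift applies to the upper bound and to the negated bound in \<open>has_level\<close>.\<close>
    obtain N where "M = Suc (Suc N)" using M by (metis add_2_eq_Suc le_Suc_ex)
    then show ?thesis by (simp add: has_level_def level)
  qed
  moreover have "level_slope F i k = level_slope F j k" if fin: "finite_level F i" "finite_level F j" for k
  proof -
    obtain M b a where ba: "\<forall>n>M. lambda F j k n = b * (of_nat n - 1) + a"
      using fin(2) unfolding finite_level_def has_level_def level_le_def by blast
    then obtain a' where "\<forall>n>Suc M. lambda F i k n = b * (of_nat n - 1) + a'"
      using lambda_affine_iff[OF ij, of M k b] by blast
    with ba fin show ?thesis by (metis level_slope_eq)
  qed
  ultimately show ?thesis by blast
qed

end
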